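(* For an integer $n\geq 4$, the maximum size of a $3$-nilpotent subsemigroup of $\mathcal T_n$ is equal to \[ \kappa(n)=\max\{\,t^{n-t}\cdot\xi(t) : t\in\{1,\dots,n\}\,\}. \]
   Context: $\mathcal T_n$ is the full transformation semigroup on $\{1,\dots,n\}$. A semigroup $S$ is nilpotent if $S^k=\{z\}$ for some integer $k\geq1$ and some $z\in S$ (where $S^k$ is the set of all products of $k$ elements of $S$); it is $k$-nilpotent if $k$ is the least such integer. For $t\in\mathbb N$, $\xi(t)=\max\{s^{t-s}: s\in\{1,\dots,t\}\}$ (with $0^0=1$). *)

theory Defs
  imports Complex_Main "HOL-Library.FuncSet"
begin

text \<open>Transformations are kept in one-to-one correspondence with self-maps of
  \<open>{1..n}\<close> by requiring the value \<^const>\<open>undefined\<close> outside of \<open>{1..n}\<close>; accordingly the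
  product is \<^const>\<open>compose\<close>, which restricts the composite to \<open>{1..n}\<close>.\<close>

definition full_transformations :: "nat \<Rightarrow> (nat \<Rightarrow> nat) set" where
  "full_transformations n = ({1..n} \<rightarrow>\<^sub>E {1..n})"

definition subsemigroup :: "('a \<Rightarrow> 'a \<Rightarrow> 'a) \<Rightarrow> 'a set \<Rightarrow> 'a set \<Rightarrow> bool" where
  "subsemigroup m S T \<longleftrightarrow> S \<noteq> {} \<and> S \<subseteq> T \<and> (\<forall>x\<in>S. \<forall>y\<in>S. m x y \<in> S)"

text \<open>The exponent 0 is a dummy case: powers of a semigroup start at exponent 1.\<close>

fun semigroup_power :: "('a \<Rightarrow> 'a \<Rightarrow> 'a) \<Rightarrow> 'a set \<Rightarrow> nat \<Rightarrow> 'a set" where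
  "semigroup_power m S 0 = {}"
| "semigroup_power m S (Suc 0) = S"
| "semigroup_power m S (Suc (Suc k)) = {m x y |x y. x \<in> S \<and> y \<in> semigroup_power m S (Suc k)}"

definition power_trivial :: "('a \<Rightarrow> 'a \<Rightarrow> 'a) \<Rightarrow> 'a set \<Rightarrow> nat \<Rightarrow> bool" where
  "power_trivial m S k \<longleftrightarrow> (\<exists>z\<in>S. semigroup_power m S k = {z})"

definition k_nilpotent :: "('a \<Rightarrow> 'a \<Rightarrow> 'a) \<Rightarrow> nat \<Rightarrow> 'a set \<Rightarrow> bool" where
  "k_nilpotent m k S \<longleftrightarrow>
     k \<ge> 1 \<and> power_trivial m S k \<and> (\<forall>j. 1 \<le> j \<and> j < k \<longrightarrow> \<not> power_trivial m S j)"

text \<open>Both maxima below are only meaningful for positive arguments.\<close>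

definition xi :: "nat \<Rightarrow> nat" where
  "xi t = Max ((\<lambda>s. s ^ (t - s)) ` {1..t})"

definition kappa :: "nat \<Rightarrow> nat" where
  "kappa n = Max ((\<lambda>t. t ^ (n - t) * xi t) ` {1..n})"

definition nilpotent_subsemigroup_sizes :: "nat \<Rightarrow> nat \<Rightarrow> nat set" where
  "nilpotent_subsemigroup_sizes k n =
     {card S |S. subsemigroup (compose {1..n}) S (full_transformations n) \<and>
                 k_nilpotent (compose {1..n}) k S}"

end

theory Submission
  imports Defs
begin

text \<open>Let \<open>z\<close> be the zero of a subsemigroup \<open>S\<close> with \<open>S\<^sup>3 = {z}\<close>. Put
  \<open>A = {x. \<forall>f\<in>S. f x = z x}\<close> and \<open>B = {x. \<forall>f\<in>S. \<forall>g\<in>S. g (f x) = z x}\<close>. As \<open>z f = z\<close> for all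
  \<open>f \<in> S\<close>, each \<open>f\<close> agrees with \<open>z\<close> on \<open>A\<close>, maps \<open>B - A\<close> into \<open>A\<close> and maps everything else
  into \<open>B\<close>. With \<open>s = card A\<close> and \<open>t = card B\<close> this leaves at most \<open>s ^ (t - s) * t ^ (n - t)\<close>
  transformations. Conversely, all maps respecting such a layering with \<open>z\<close> constant form a
  semigroup with trivial cube, and for \<open>n \<ge> 4\<close> the maximum is attained at some \<open>1 < s < t < n\<close>,
  where the square is not trivial.\<close>

section \<open>Counting layered maps\<close>

definition layered_maps :: "'a set \<Rightarrow> ('a \<Rightarrow> 'a) \<Rightarrow> 'a set \<Rightarrow> 'a set \<Rightarrow> ('a \<Rightarrow> 'a) set" where
  "layered_maps X z A B = (\<Pi>\<^sub>E x\<in>X. if x \<in> A then {z x} else if x \<in> B then A else B)"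

lemma finite_layered_maps:
  assumes "finite X" "A \<subseteq> B" "B \<subseteq> X"
  shows "finite (layered_maps X z A B)"
proof -
  have "finite B" "finite A" using assms by (auto intro: finite_subset[of B X] finite_subset[of A X])
  then show ?thesis
    unfolding layered_maps_def using \<open>finite X\<close> by (intro finite_PiE) auto
qed

text \<open>The size is the product of the fibre sizes over the layers \<open>X - B\<close>,
  \<open>B - A\<close> and \<open>A\<close>; the last contributes only factors 1.\<close>

lemma card_layered_maps:
  assumes "finite X" "A \<subseteq> B" "B \<subseteq> X"
  shows "card (layered_maps X z A B) =
    card B ^ (card X - card B) * card A ^ (card B - card A)"
proof -
  let ?F = "\<lambda>x. if x \<in> A then {z x} else if x \<in> B then A else B"
  have fin: "finite B" "finite A" using assms by (auto intro: finite_subset[of B X] finite_subset[of A X])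
  have "card (layered_maps X z A B) = (\<Prod>x\<in>X. card (?F x))"
    unfolding layered_maps_def by (rule card_PiE) fact
  also have "\<dots> = (\<Prod>x\<in>X - B. card (?F x)) * (\<Prod>x\<in>B. card (?F x))"
    by (rule prod.subset_diff) fact+
  also have "(\<Prod>x\<in>B. card (?F x)) = (\<Prod>x\<in>B - A. card (?F x)) * (\<Prod>x\<in>A. card (?F x))"
    by (rule prod.subset_diff) fact+
  also have "(\<Prod>x\<in>A. card (?F x)) = 1" by simp
  also have "(\<Prod>x\<in>B - A. card (?F x)) = (\<Prod>x\<in>B - A. card A)"
    by (rule prod.cong) auto
  also have "(\<Prod>x\<in>X - B. card (?F x)) = (\<Prod>x\<in>X - B. card B)"
    using \<open>A \<subseteq> B\<close> by (intro prod.cong) auto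
  finally show ?thesis
    using fin assms by (simp add: card_Diff_subset)
qed

section \<open>Arithmetic of \<open>xi\<close> and \<open>kappa\<close>\<close>

lemma le_xi:
  assumes "1 \<le> s" "s \<le> t"
  shows "s ^ (t - s) \<le> xi t"
  unfolding xi_def using assms by (intro Max_ge) auto

lemma le_kappa:
  assumes "1 \<le> s" "s \<le> t" "t \<le> n"
  shows "t ^ (n - t) * s ^ (t - s) \<le> kappa n"
proof -
  have "t ^ (n - t) * s ^ (t - s) \<le> t ^ (n - t) * xi t"
    using le_xi assms by simp
  also have "\<dots> \<le> kappa n"
    unfolding kappa_def using assms by (intro Max_ge) auto
  finally show ?thesis .
qed

lemma kappa_attained:
  assumes "1 \<le> n"
  obtains s t where "1 \<le> s" "s \<le> t" "t \<le> n" "kappa n = t ^ (n - t) * s ^ (t - s)"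
proof -
  have "kappa n \<in> (\<lambda>t. t ^ (n - t) * xi t) ` {1..n}"
    unfolding kappa_def using assms by (intro Max_in) auto
  then obtain t where t: "1 \<le> t" "t \<le> n" "kappa n = t ^ (n - t) * xi t" by auto
  have "xi t \<in> (\<lambda>s. s ^ (t - s)) ` {1..t}"
    unfolding xi_def using t by (intro Max_in) auto
  then show ?thesis using t that by auto
qed

text \<open>Disposes of degenerate layerings, whose counts reduce to a single power. For
  \<open>u \<ge> 3\<close> a bottom layer of size 2 inside one of size \<open>u\<close> only adds
  the factor \<open>2 ^ (u - 2)\<close>; smaller \<open>u\<close> are beaten by sizes 2 and 3, and 3
  < n since n \<ge> 4.\<close>

lemma power_diff_le_proper_layers:
  fixes n u :: nat
  assumes "n \<ge> 4" "1 \<le> u" "u < n"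
  shows "\<exists>s t. 1 < s \<and> s < t \<and> t < n \<and> u ^ (n - u) \<le> t ^ (n - t) * s ^ (t - s)"
proof (cases "u \<ge> 3")
  case True
  then show ?thesis
    using assms by (intro exI[of _ 2] exI[of _ u]) simp
next
  case False
  have "u ^ (n - u) \<le> 2 ^ (n - 2)"
  proof (cases "u = 1")
    case False
    with \<open>\<not> u \<ge> 3\<close> assms have "u = 2" by simp
    then show ?thesis by simp
  qed simp
  also have "(2::nat) ^ (n - 2) = 2 ^ (n - 3) * 2"
  proof -
    have "n - 2 = Suc (n - 3)" using assms by simp
    then show ?thesis by simp
  qed
  also have "\<dots> \<le> 3 ^ (n - 3) * 2 ^ (3 - 2)"
    by (simp add: power_mono)
  finally show ?thesis
    using assms by (intro exI[of _ 2] exI[of _ 3]) simp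
qed

lemma kappa_attained_properly:
  assumes "n \<ge> 4"
  obtains s t where "1 < s" "s < t" "t < n" "kappa n = t ^ (n - t) * s ^ (t - s)"
proof -
  obtain s t where st: "1 \<le> s" "s \<le> t" "t \<le> n" and eq: "kappa n = t ^ (n - t) * s ^ (t - s)"
    using kappa_attained[of n] assms by auto
  have "\<exists>s' t'. 1 < s' \<and> s' < t' \<and> t' < n \<and> kappa n \<le> t' ^ (n - t') * s' ^ (t' - s')"
  proof (cases "1 < s \<and> s < t \<and> t < n")
    case True
    then show ?thesis using eq by (metis order_refl)
  next
    case False
    \<comment> \<open>If \<open>t < n\<close>, the factor in \<open>s\<close> is 1 and
      \<open>u = t\<close> works. If \<open>t = n\<close>, the factor in \<open>t\<close> is 1,
      which leaves \<open>s ^ (n - s)\<close> and \<open>u = s\<close>; for \<open>s = n\<close>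
      this is 1, so \<open>u = 1\<close> suffices.\<close>
    have "\<exists>u. 1 \<le> u \<and> u < n \<and> kappa n \<le> u ^ (n - u)"
    proof (cases "t < n")
      case True
      then have "s = 1 \<or> s = t" using False st by linarith
      then have "s ^ (t - s) = 1" by auto
      then show ?thesis using eq True st by (intro exI[of _ t]) (simp del: One_nat_def)
    next
      case False
      then have "t = n" using st by simp
      show ?thesis
      proof (cases "s = n")
        case True
        then show ?thesis using eq \<open>t = n\<close> assms by (intro exI[of _ 1]) simp
      next
        case False
        then show ?thesis using eq \<open>t = n\<close> st by (intro exI[of _ s]) simp
      qed
    qed
    then show ?thesis
      using power_diff_le_proper_layers[OF assms] order_trans by metis
  qed
  then obtain s' t' where "1 < s'" "s' < t'" "t' < n" "kappa n \<le> t' ^ (n - t') * s' ^ (t' - s')"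
    by blast
  moreover from this have "t' ^ (n - t') * s' ^ (t' - s') \<le> kappa n"
    by (intro le_kappa) auto
  ultimately show ?thesis using that by (meson le_antisym)
qed

section \<open>Upper bound from a trivial cube\<close>

lemma semigroup_power_2:
  "semigroup_power m S 2 = {m x y |x y. x \<in> S \<and> y \<in> S}"
  by (simp add: numeral_2_eq_2)

lemma semigroup_power_3:
  "semigroup_power m S 3 = {m x (m y w) |x y w. x \<in> S \<and> y \<in> S \<and> w \<in> S}"
  by (auto simp: numeral_3_eq_3)

lemma trivial_cube_subset_layered_maps:
  assumes sub: "subsemigroup (compose X) S (X \<rightarrow>\<^sub>E X)"
    and triv: "semigroup_power (compose X) S 3 = {z}"
    and "X \<noteq> {}"
  obtains A B where "A \<noteq> {}" "A \<subseteq> B" "B \<subseteq> X" "S \<subseteq> layered_maps X z A B"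
proof -
  have in_X: "f x \<in> X" if "f \<in> S" "x \<in> X" for f x
    using sub that by (auto simp: subsemigroup_def)
  have closed: "compose X f g \<in> S" if "f \<in> S" "g \<in> S" for f g
    using sub that by (auto simp: subsemigroup_def)
  have cube: "compose X f (compose X g h) = z" if "f \<in> S" "g \<in> S" "h \<in> S" for f g h
    using triv that unfolding semigroup_power_3 by blast
  have cube_apply: "f (g (h x)) = z x" if "f \<in> S" "g \<in> S" "h \<in> S" "x \<in> X" for f g h x
    using cube[OF that(1-3)] that in_X by (auto simp: compose_eq dest!: fun_cong[of _ _ x])
  obtain f0 where f0: "f0 \<in> S" using sub by (auto simp: subsemigroup_def)
  have zS: "z \<in> S" using cube[OF f0 f0 f0] closed f0 by metis
  \<comment> \<open>Bracket the fourfold product \<open>f0 f0 f0 f\<close> in two ways: as three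
    factors ending in \<open>f0 f\<close> it gives \<open>z x\<close>, and as the cube of
    \<open>f0\<close> applied to \<open>f x\<close> it gives \<open>z (f x)\<close>. The next fact
    is dual.\<close>
  have z_right: "z (f x) = z x" if "f \<in> S" "x \<in> X" for f x
    using cube_apply[of f0 f0 "compose X f0 f" x] cube_apply[of f0 f0 f0 "f x"] that f0 closed in_X
    by (simp add: compose_eq)
  have z_left: "f (z x) = z x" if "f \<in> S" "x \<in> X" for f x
    using cube_apply[of "compose X f f0" f0 f0 x] cube_apply[of f0 f0 f0 x] that f0 closed in_X
    by (simp add: compose_eq)
  define A where "A = {x \<in> X. \<forall>f\<in>S. f x = z x}"
  define B where "B = {x \<in> X. \<forall>f\<in>S. \<forall>g\<in>S. g (f x) = z x}"
  show ?thesis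
  proof
    obtain a where "a \<in> X" using \<open>X \<noteq> {}\<close> by blast
    \<comment> \<open>By \<open>z_left\<close>, every element of \<open>S\<close> fixes the points
      in the image of \<open>z\<close>.\<close>
    then have "z a \<in> A" using zS by (auto simp: A_def in_X z_left)
    then show "A \<noteq> {}" by blast
    show "A \<subseteq> B" by (auto simp: A_def B_def z_left)
    show "B \<subseteq> X" by (auto simp: B_def)
    show "S \<subseteq> layered_maps X z A B"
    proof
      fix f assume f: "f \<in> S"
      then have "f \<in> extensional X" using sub by (auto simp: subsemigroup_def PiE_def)
      moreover have "f x \<in> (if x \<in> A then {z x} else if x \<in> B then A else B)" if "x \<in> X" for x
      proof -
        \<comment> \<open>For \<open>g\<close> in \<open>S\<close>,
          \<open>g (f x) = z x = z (f x)\<close>. The inclusion in \<open>B\<close> below is the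
          same argument with one more factor.\<close>
        have "f x \<in> A" if "x \<in> B"
          using that in_X[OF f] z_right[OF f] f unfolding A_def B_def mem_Collect_eq by metis
        moreover have "f x \<in> B"
          using f \<open>x \<in> X\<close> by (simp add: B_def in_X z_right cube_apply)
        moreover have "f x = z x" if "x \<in> A"
          using f that by (simp add: A_def)
        ultimately show ?thesis by simp
      qed
      ultimately show "f \<in> layered_maps X z A B"
        by (auto simp: layered_maps_def PiE_def)
    qed
  qed
qed

lemma trivial_cube_card_le_kappa:
  assumes "n \<ge> 1"
    and "subsemigroup (compose {1..n}) S (full_transformations n)"
    and "power_trivial (compose {1..n}) S 3"
  shows "card S \<le> kappa n"
proof -
  obtain z where "semigroup_power (compose {1..n}) S 3 = {z}"
    using assms(3) by (auto simp: power_trivial_def)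
  moreover have "{1..n} \<noteq> {}" using assms(1) by simp
  ultimately obtain A B where AB: "A \<noteq> {}" "A \<subseteq> B" "B \<subseteq> {1..n}"
    and S: "S \<subseteq> layered_maps {1..n} z A B"
    using trivial_cube_subset_layered_maps assms(2)[unfolded full_transformations_def] by metis
  have finB: "finite B" using AB(3) by (rule finite_subset) simp
  have finA: "finite A" using AB(2) finB by (rule finite_subset)
  have "card S \<le> card (layered_maps {1..n} z A B)"
    using S AB by (intro card_mono finite_layered_maps) auto
  also have "\<dots> = card B ^ (n - card B) * card A ^ (card B - card A)"
    using AB by (simp add: card_layered_maps)
  also have "\<dots> \<le> kappa n"
  proof (rule le_kappa)
    show "1 \<le> card A" using AB finA by (simp add: Suc_le_eq card_gt_0_iff)
    show "card A \<le> card B" using AB finB by (simp add: card_mono)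
    show "card B \<le> n" using card_mono[of "{1..n}" B] AB by simp
  qed
  finally show ?thesis .
qed

text \<open>Each factor moves points one layer down, from \<open>X\<close> to \<open>B\<close> to
  \<open>A\<close> to \<open>a\<close>, so three factors give the constant map. Strict inclusions
  between the layers keep two factors from doing so.\<close>

lemma layered_maps_3_nilpotent:
  assumes "a \<in> A" "A \<subseteq> B" "B \<subseteq> X" "A \<noteq> {a}" "A \<noteq> B" "B \<noteq> X"
  defines "S \<equiv> layered_maps X (\<lambda>_. a) A B"
  shows "subsemigroup (compose X) S (X \<rightarrow>\<^sub>E X)" "k_nilpotent (compose X) 3 S"
proof -
  let ?z = "\<lambda>x\<in>X. a"
  obtain s t u where s: "s \<in> A" "s \<noteq> a" and t: "t \<in> B" "t \<notin> A" and u: "u \<in> X" "u \<notin> B"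
    using assms by blast
  have mem: "f x \<in> (if x \<in> A then {a} else if x \<in> B then A else B)" if "f \<in> S" "x \<in> X" for f x
    using that unfolding S_def layered_maps_def by (rule PiE_mem)
  have onA: "f x = a" if "f \<in> S" "x \<in> A" for f x
    using mem[OF that(1), of x] that \<open>A \<subseteq> B\<close> \<open>B \<subseteq> X\<close> by auto
  \<comment> \<open>This covers all of \<open>B\<close>, not only \<open>B - A\<close>, because the
    prescribed value \<open>a\<close> on \<open>A\<close> lies in \<open>A\<close>.\<close>
  have onB: "f x \<in> A" if "f \<in> S" "x \<in> B" for f x
    using mem[OF that(1), of x] that \<open>a \<in> A\<close> \<open>B \<subseteq> X\<close> by (auto split: if_splits)
  have onX: "f x \<in> B" if "f \<in> S" "x \<in> X" for f x
    using mem[OF that] \<open>a \<in> A\<close> \<open>A \<subseteq> B\<close> by (auto split: if_splits)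
  have memI: "(\<lambda>x\<in>X. h x) \<in> S"
    if "\<And>x. x \<in> A \<Longrightarrow> h x = a" "\<And>x. x \<in> B \<Longrightarrow> h x \<in> A" "\<And>x. x \<in> X \<Longrightarrow> h x \<in> B" for h
    unfolding S_def layered_maps_def using that by simp
  have zS: "?z \<in> S" using \<open>a \<in> A\<close> \<open>A \<subseteq> B\<close> by (intro memI) auto
  have closed: "compose X f g \<in> S" if "f \<in> S" "g \<in> S" for f g
    unfolding compose_def
  proof (rule memI)
    show "f (g x) = a" if "x \<in> A" for x
      using that \<open>f \<in> S\<close> \<open>g \<in> S\<close> \<open>A \<subseteq> B\<close> by (blast intro: onA onB)
    show "f (g x) \<in> A" if "x \<in> B" for x
      using that \<open>f \<in> S\<close> \<open>g \<in> S\<close> \<open>B \<subseteq> X\<close> by (blast intro: onB onX)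
    show "f (g x) \<in> B" if "x \<in> X" for x
      using that \<open>f \<in> S\<close> \<open>g \<in> S\<close> \<open>B \<subseteq> X\<close> by (blast intro: onX)
  qed
  have subX: "S \<subseteq> (X \<rightarrow>\<^sub>E X)"
  proof
    fix f assume f: "f \<in> S"
    then have "f \<in> extensional X" by (auto simp: S_def layered_maps_def PiE_def)
    then show "f \<in> X \<rightarrow>\<^sub>E X" using onX[OF f] \<open>B \<subseteq> X\<close> by (auto simp: PiE_def)
  qed
  show "subsemigroup (compose X) S (X \<rightarrow>\<^sub>E X)"
    unfolding subsemigroup_def using zS closed subX by blast
  have "compose X f (compose X g h) = ?z" if "f \<in> S" "g \<in> S" "h \<in> S" for f g h
    using that onA onB onX by (auto simp: compose_def fun_eq_iff)
  then have "semigroup_power (compose X) S 3 = {?z}"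
    unfolding semigroup_power_3 using zS by (intro equalityI subsetI) (auto, metis)
  then have triv3: "power_trivial (compose X) S 3"
    unfolding power_trivial_def using zS by blast
  \<comment> \<open>These realise the chain from \<open>u\<close> via \<open>t\<close> to
    \<open>s\<close>: \<open>f\<close> alone already differs from the zero at \<open>u\<close>, and
    \<open>g\<close> after \<open>f\<close> sends \<open>u\<close> to \<open>s\<close>, which is not
    \<open>a\<close>.\<close>
  define f where "f = (\<lambda>x\<in>X. if x = u then t else a)"
  define g where "g = (\<lambda>x\<in>X. if x = t then s else a)"
  have fS: "f \<in> S"
    unfolding f_def using assms(1-3) t u by (intro memI) auto
  have gS: "g \<in> S"
    unfolding g_def using assms(1-3) s t by (intro memI) auto
  have "f u \<noteq> ?z u" using \<open>a \<in> A\<close> t u by (auto simp: f_def)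
  then have triv1: "\<not> power_trivial (compose X) S 1"
    using fS zS by (auto simp: power_trivial_def)
  have "compose X g f u \<noteq> compose X ?z ?z u"
    using assms(1-3) s t u by (auto simp: f_def g_def compose_def)
  then have "compose X g f \<noteq> compose X ?z ?z" by metis
  moreover have "compose X g f \<in> semigroup_power (compose X) S 2"
    "compose X ?z ?z \<in> semigroup_power (compose X) S 2"
    unfolding semigroup_power_2 using fS gS zS by blast+
  ultimately have triv2: "\<not> power_trivial (compose X) S 2"
    unfolding power_trivial_def by auto
  have "j = 1 \<or> j = 2" if "1 \<le> j" "j < 3" for j :: nat using that by auto
  then show "k_nilpotent (compose X) 3 S"
    unfolding k_nilpotent_def using triv1 triv2 triv3 by auto
qed

theorem theorem4p15:
  fixes n :: nat
  assumes "n \<ge> 4"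
  shows "kappa n \<in> nilpotent_subsemigroup_sizes 3 n
       \<and> (\<forall>m \<in> nilpotent_subsemigroup_sizes 3 n. m \<le> kappa n)"
proof
  obtain s t where st: "1 < s" "s < t" "t < n" and eq: "kappa n = t ^ (n - t) * s ^ (t - s)"
    using kappa_attained_properly[OF assms] .
  \<comment> \<open>Initial segments provide nested layers of sizes \<open>s\<close> and
    \<open>t\<close>, with zero the constant map 1.\<close>
  let ?S = "layered_maps {1..n} (\<lambda>_. 1) {1..s} {1..t}"
  \<comment> \<open>The layers are distinct because their sizes satisfy 1 < s < t < n.\<close>
  have neq: "{1..s} \<noteq> {1}" "{1..s} \<noteq> {1..t}" "{1..t} \<noteq> {1..n}"
    using st by (auto dest: arg_cong[of _ _ card])
  have "card ?S = kappa n"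
    using st eq by (simp add: card_layered_maps)
  moreover have "subsemigroup (compose {1..n}) ?S (full_transformations n)"
    unfolding full_transformations_def
    using st neq by (intro layered_maps_3_nilpotent) auto
  moreover have "k_nilpotent (compose {1..n}) 3 ?S"
    using st neq by (intro layered_maps_3_nilpotent) auto
  ultimately show "kappa n \<in> nilpotent_subsemigroup_sizes 3 n"
    unfolding nilpotent_subsemigroup_sizes_def mem_Collect_eq by metis
  show "\<forall>m \<in> nilpotent_subsemigroup_sizes 3 n. m \<le> kappa n"
    using assms trivial_cube_card_le_kappa
    by (auto simp: nilpotent_subsemigroup_sizes_def k_nilpotent_def)
qed

end
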